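(* Let $(A,\cdot)$ be an anti-flexible algebra, $(M,l,r)$ a bimodule of $(A,\cdot)$, and let $T_1,T_2:M\to A$ be two compatible Rota-Baxter operators on $(A,\cdot)$ with respect to $(M,l,r)$. If $T_2$ is invertible, then $(T_2,\;N=T_1\circ T_2^{-1},\;S=T_2^{-1}\circ T_1)$ is an $\mathcal{ON}$-structure on the $A$-bimodule $M$.
   Context: All vector spaces are finite-dimensional over the complex field $\mathbb{K}$; $gl(V)$ denotes the linear endomorphisms of $V$. An anti-flexible algebra is a vector space $A$ with a bilinear product $\cdot$ such that $(a\cdot b)\cdot c-a\cdot(b\cdot c)=(c\cdot b)\cdot a-c\cdot(b\cdot a)$ for all $a,b,c\in A$. A bimodule of $(A,\cdot)$ is a triple $(M,l,r)$ with $M$ a vector space and $l,r:A\to gl(M)$ linear maps such that for all $a,b\in A$: $l(a\cdot b)-l(a)l(b)=r(a)r(b)-r(b\cdot a)$ and $l(a)r(b)-r(b)l(a)=l(b)r(a)-r(a)l(b)$. A Rota-Baxter operator on $(A,\cdot)$ with respect to $(M,l,r)$ is a linear map $T:M\to A$ with $T(m)\cdot T(n)=T(l(T(m))n+r(T(n))m)$ for all $m,n\in M$. Two Rota-Baxter operators $T_1,T_2:M\to A$ (with respect to the same bimodule) are compatible if $T_1+T_2$ is also a Rota-Baxter operator. A Nijenhuis operator on $(A,\cdot)$ is a linear map $N:A\to A$ with $N(a)\cdot N(b)=N(N(a)\cdot b+a\cdot N(b)-N(a\cdot b))$ for all $a,b\in A$. A Nijenhuis structure on the $A$-bimodule $M$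 is a pair $(N,S)$ with $N\in gl(A)$ a Nijenhuis operator on $(A,\cdot)$ and $S\in gl(M)$ such that for all $a\in A$, $m\in M$: $l(N(a))S(m)=S(l(N(a))m)+l(a)S^2(m)-S(l(a)S(m))$ and $r(N(a))S(m)=S(r(N(a))m)+r(a)S^2(m)-S(r(a)S(m))$. For a linear map $T:M\to A$ put $m\star_T n=l(T(m))n+r(T(n))m$, and for $S\in gl(M)$ put $m\star_T^S n=S(m)\star_T n+m\star_T S(n)-S(m\star_T n)$. An $\mathcal{ON}$-structure on the $A$-bimodule $M$ is a triple $(T,N,S)$ where $T:M\to A$ is a Rota-Baxter operator, $(N,S)$ is a Nijenhuis structure on the $A$-bimodule $M$, $N\circ T=T\circ S$, and $m\star_{N\circ T}n=m\star_T^S n$ for all $m,n\in M$. *)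

theory Defs
  imports Complex_Main
begin

text \<open>
  A complex vector space is a type of class \<open>ab_group_add\<close> with an explicit scalar multiplication,
  and the whole type is the carrier. Below, \<open>sA\<close> and \<open>sM\<close> are the scalar multiplications of \<open>A\<close>
  and \<open>M\<close>, and \<open>mul\<close> is the product of \<open>A\<close>.
\<close>

type_synonym 'v cscale = "complex \<Rightarrow> 'v \<Rightarrow> 'v"

definition fin_dim_complex_space :: "'v::ab_group_add cscale \<Rightarrow> bool" where
  "fin_dim_complex_space s \<longleftrightarrow> (\<exists>B. finite_dimensional_vector_space s B)"

definition anti_flexible_algebra ::
    "'a::ab_group_add cscale \<Rightarrow> ('a \<Rightarrow> 'a \<Rightarrow> 'a) \<Rightarrow> bool" where
  "anti_flexible_algebra sA mul \<longleftrightarrow>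
     fin_dim_complex_space sA \<and>
     (\<forall>a. Vector_Spaces.linear sA sA (\<lambda>b. mul a b)) \<and>
     (\<forall>b. Vector_Spaces.linear sA sA (\<lambda>a. mul a b)) \<and>
     (\<forall>a b c. mul (mul a b) c - mul a (mul b c) = mul (mul c b) a - mul c (mul b a))"

text \<open>
  A linear map \<open>A \<rightarrow> gl(M)\<close> is a curried function: its values are linear endomorphisms of \<open>M\<close>,
  and it is linear in its first argument for the pointwise vector space structure of \<open>gl(M)\<close>.
\<close>

definition linear_to_gl ::
    "'a::ab_group_add cscale \<Rightarrow> 'm::ab_group_add cscale \<Rightarrow> ('a \<Rightarrow> 'm \<Rightarrow> 'm) \<Rightarrow> bool" where
  "linear_to_gl sA sM f \<longleftrightarrow>
     (\<forall>a. Vector_Spaces.linear sM sM (f a)) \<and>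
     (\<forall>m. Vector_Spaces.linear sA sM (\<lambda>a. f a m))"

definition anti_flexible_bimodule ::
    "'a::ab_group_add cscale \<Rightarrow> ('a \<Rightarrow> 'a \<Rightarrow> 'a) \<Rightarrow> 'm::ab_group_add cscale
      \<Rightarrow> ('a \<Rightarrow> 'm \<Rightarrow> 'm) \<Rightarrow> ('a \<Rightarrow> 'm \<Rightarrow> 'm) \<Rightarrow> bool" where
  "anti_flexible_bimodule sA mul sM l r \<longleftrightarrow>
     fin_dim_complex_space sM \<and>
     linear_to_gl sA sM l \<and> linear_to_gl sA sM r \<and>
     (\<forall>a b m. l (mul a b) m - l a (l b m) = r a (r b m) - r (mul b a) m) \<and>
     (\<forall>a b m. l a (r b m) - r b (l a m) = l b (r a m) - r a (l b m))"

definition rota_baxter_operator ::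
    "'a::ab_group_add cscale \<Rightarrow> ('a \<Rightarrow> 'a \<Rightarrow> 'a) \<Rightarrow> 'm::ab_group_add cscale
      \<Rightarrow> ('a \<Rightarrow> 'm \<Rightarrow> 'm) \<Rightarrow> ('a \<Rightarrow> 'm \<Rightarrow> 'm) \<Rightarrow> ('m \<Rightarrow> 'a) \<Rightarrow> bool" where
  "rota_baxter_operator sA mul sM l r T \<longleftrightarrow>
     Vector_Spaces.linear sM sA T \<and>
     (\<forall>m n. mul (T m) (T n) = T (l (T m) n + r (T n) m))"

definition compatible_rota_baxter_operators ::
    "'a::ab_group_add cscale \<Rightarrow> ('a \<Rightarrow> 'a \<Rightarrow> 'a) \<Rightarrow> 'm::ab_group_add cscale
      \<Rightarrow> ('a \<Rightarrow> 'm \<Rightarrow> 'm) \<Rightarrow> ('a \<Rightarrow> 'm \<Rightarrow> 'm) \<Rightarrow> ('m \<Rightarrow> 'a) \<Rightarrow> ('m \<Rightarrow> 'a) \<Rightarrow> bool" where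
  "compatible_rota_baxter_operators sA mul sM l r T\<^sub>1 T\<^sub>2 \<longleftrightarrow>
     rota_baxter_operator sA mul sM l r T\<^sub>1 \<and>
     rota_baxter_operator sA mul sM l r T\<^sub>2 \<and>
     rota_baxter_operator sA mul sM l r (\<lambda>m. T\<^sub>1 m + T\<^sub>2 m)"

definition nijenhuis_operator ::
    "'a::ab_group_add cscale \<Rightarrow> ('a \<Rightarrow> 'a \<Rightarrow> 'a) \<Rightarrow> ('a \<Rightarrow> 'a) \<Rightarrow> bool" where
  "nijenhuis_operator sA mul N \<longleftrightarrow>
     Vector_Spaces.linear sA sA N \<and>
     (\<forall>a b. mul (N a) (N b) = N (mul (N a) b + mul a (N b) - N (mul a b)))"

definition nijenhuis_structure ::
    "'a::ab_group_add cscale \<Rightarrow> ('a \<Rightarrow> 'a \<Rightarrow> 'a) \<Rightarrow> 'm::ab_group_add cscale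
      \<Rightarrow> ('a \<Rightarrow> 'm \<Rightarrow> 'm) \<Rightarrow> ('a \<Rightarrow> 'm \<Rightarrow> 'm) \<Rightarrow> ('a \<Rightarrow> 'a) \<Rightarrow> ('m \<Rightarrow> 'm) \<Rightarrow> bool" where
  "nijenhuis_structure sA mul sM l r N S \<longleftrightarrow>
     nijenhuis_operator sA mul N \<and>
     Vector_Spaces.linear sM sM S \<and>
     (\<forall>a m. l (N a) (S m) = S (l (N a) m) + l a (S (S m)) - S (l a (S m))) \<and>
     (\<forall>a m. r (N a) (S m) = S (r (N a) m) + r a (S (S m)) - S (r a (S m)))"

definition star ::
    "('a \<Rightarrow> 'm \<Rightarrow> 'm::ab_group_add) \<Rightarrow> ('a \<Rightarrow> 'm \<Rightarrow> 'm) \<Rightarrow> ('m \<Rightarrow> 'a) \<Rightarrow> 'm \<Rightarrow> 'm \<Rightarrow> 'm" where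
  "star l r T m n = l (T m) n + r (T n) m"

definition deformed_star ::
    "('a \<Rightarrow> 'm \<Rightarrow> 'm::ab_group_add) \<Rightarrow> ('a \<Rightarrow> 'm \<Rightarrow> 'm) \<Rightarrow> ('m \<Rightarrow> 'a) \<Rightarrow> ('m \<Rightarrow> 'm)
      \<Rightarrow> 'm \<Rightarrow> 'm \<Rightarrow> 'm" where
  "deformed_star l r T S m n = star l r T (S m) n + star l r T m (S n) - S (star l r T m n)"

definition ON_structure ::
    "'a::ab_group_add cscale \<Rightarrow> ('a \<Rightarrow> 'a \<Rightarrow> 'a) \<Rightarrow> 'm::ab_group_add cscale
      \<Rightarrow> ('a \<Rightarrow> 'm \<Rightarrow> 'm) \<Rightarrow> ('a \<Rightarrow> 'm \<Rightarrow> 'm)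
      \<Rightarrow> ('m \<Rightarrow> 'a) \<Rightarrow> ('a \<Rightarrow> 'a) \<Rightarrow> ('m \<Rightarrow> 'm) \<Rightarrow> bool" where
  "ON_structure sA mul sM l r T N S \<longleftrightarrow>
     rota_baxter_operator sA mul sM l r T \<and>
     nijenhuis_structure sA mul sM l r N S \<and>
     N \<circ> T = T \<circ> S \<and>
     (\<forall>m n. star l r (N \<circ> T) m n = deformed_star l r T S m n)"

end

theory Submission imports Defs begin

text \<open>
  Write \<open>m \<star>\<^sub>i n\<close> for \<open>star l r T\<^sub>i m n\<close>. The Rota-Baxter identity says that \<open>T\<^sub>i\<close> carries \<open>\<star>\<^sub>i\<close> to
  the product of \<open>A\<close>. Expanding it for \<open>T\<^sub>1 + T\<^sub>2\<close> and cancelling the pure terms leaves the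
  cross identity
  \<open>T\<^sub>1 m \<cdot> T\<^sub>2 n + T\<^sub>2 m \<cdot> T\<^sub>1 n = T\<^sub>1 (m \<star>\<^sub>2 n) + T\<^sub>2 (m \<star>\<^sub>1 n)\<close>, which is the whole content of
  compatibility.

  Let \<open>N = T\<^sub>1 \<circ> T\<^sub>2\<inverse>\<close> and \<open>S = T\<^sub>2\<inverse> \<circ> T\<^sub>1\<close>, so that \<open>N \<circ> T\<^sub>2 = T\<^sub>1 = T\<^sub>2 \<circ> S\<close>. As \<open>T\<^sub>2\<close> is
  surjective, \<open>N\<close> can be tested on elements \<open>T\<^sub>2 m\<close>; as it is injective, identities in \<open>M\<close> can be
  tested after applying \<open>T\<^sub>2\<close>. The cross identity then becomes the Nijenhuis identity for \<open>N\<close> when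
  \<open>N\<close> is applied to it, and the equality of \<open>\<star>\<^sub>1\<close> with the \<open>S\<close>-deformation of \<open>\<star>\<^sub>2\<close> when it is
  pulled back along \<open>T\<^sub>2\<close>.

  The two mixed identities relating \<open>S\<close> to \<open>l\<close> and \<open>r\<close> follow from two facts. One is that
  in the deformation identity the terms with \<open>l (T\<^sub>1 m)\<close> and \<open>r (T\<^sub>1 n)\<close> cancel, leaving
  \<open>S (m \<star>\<^sub>2 n) = l (T\<^sub>2 m) (S n) + r (T\<^sub>2 n) (S m)\<close> (\<open>intertwiner_twisted_derivation\<close>).
  The other is that \<open>S\<close> is a homomorphism from \<open>\<star>\<^sub>1\<close> to \<open>\<star>\<^sub>2\<close>
  (\<open>intertwiner_star_hom\<close>), because both sides map under \<open>T\<^sub>2\<close> to \<open>T\<^sub>1 m \<cdot> T\<^sub>1 n\<close>.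
  Each mixed identity involves only one of \<open>l\<close> and \<open>r\<close>. Evaluating the first fact at a pair with
  one entry of the form \<open>S m\<close>, its terms in the other action become those of the second fact, because
  \<open>T\<^sub>2 (S m) = T\<^sub>1 m\<close>; subtracting eliminates them.
\<close>

lemma linear_inv_bij:
  assumes "Vector_Spaces.linear s\<^sub>1 s\<^sub>2 f" "bij f"
  shows "Vector_Spaces.linear s\<^sub>2 s\<^sub>1 (inv f)"
proof -
  interpret Vector_Spaces.linear s\<^sub>1 s\<^sub>2 f by fact
  have [simp]: "f (inv f y) = y" "inv f (f x) = x" for x y
    using assms(2) by (simp_all add: bij_is_surj surj_f_inv_f bij_is_inj)
  show ?thesis
  proof (unfold_locales)
    fix x y c
    show "inv f (x + y) = inv f x + inv f y"
      by (rule injD[OF bij_is_inj[OF assms(2)]]) (simp add: add)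
    show "inv f (s\<^sub>2 c x) = s\<^sub>1 c (inv f x)"
      by (rule injD[OF bij_is_inj[OF assms(2)]]) (simp add: scale)
  qed
qed

lemma linear_map_add:
  assumes "Vector_Spaces.linear s\<^sub>1 s\<^sub>2 f"
  shows "f (x + y) = f x + f y"
proof -
  interpret Vector_Spaces.linear s\<^sub>1 s\<^sub>2 f by fact
  show ?thesis by (rule add)
qed

lemma linear_map_diff:
  assumes "Vector_Spaces.linear s\<^sub>1 s\<^sub>2 f"
  shows "f (x - y) = f x - f y"
proof -
  interpret Vector_Spaces.linear s\<^sub>1 s\<^sub>2 f by fact
  show ?thesis by (rule diff)
qed

lemma rota_baxter_star:
  assumes "rota_baxter_operator sA mul sM l r T"
  shows "mul (T m) (T n) = T (star l r T m n)"
  using assms by (simp add: rota_baxter_operator_def star_def)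

lemma compatible_cross_identity:
  assumes alg: "anti_flexible_algebra sA mul"
    and bim: "anti_flexible_bimodule sA mul sM l r"
    and comp: "compatible_rota_baxter_operators sA mul sM l r T\<^sub>1 T\<^sub>2"
  shows "mul (T\<^sub>1 m) (T\<^sub>2 n) + mul (T\<^sub>2 m) (T\<^sub>1 n) = T\<^sub>1 (star l r T\<^sub>2 m n) + T\<^sub>2 (star l r T\<^sub>1 m n)"
proof -
  have rb1: "rota_baxter_operator sA mul sM l r T\<^sub>1"
    and rb2: "rota_baxter_operator sA mul sM l r T\<^sub>2"
    and rb12: "rota_baxter_operator sA mul sM l r (\<lambda>m. T\<^sub>1 m + T\<^sub>2 m)"
    using comp by (auto simp: compatible_rota_baxter_operators_def)
  have lin: "Vector_Spaces.linear sM sA T\<^sub>1" "Vector_Spaces.linear sM sA T\<^sub>2"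
    using rb1 rb2 by (auto simp: rota_baxter_operator_def)
  have mulL: "Vector_Spaces.linear sA sA (\<lambda>x. mul x y)"
    and mulR: "Vector_Spaces.linear sA sA (\<lambda>x. mul y x)" for y
    using alg by (auto simp: anti_flexible_algebra_def)
  have act: "Vector_Spaces.linear sA sM (\<lambda>a. l a k)" "Vector_Spaces.linear sA sM (\<lambda>a. r a k)" for k
    using bim by (auto simp: anti_flexible_bimodule_def linear_to_gl_def)
  have "star l r (\<lambda>m. T\<^sub>1 m + T\<^sub>2 m) m n = star l r T\<^sub>1 m n + star l r T\<^sub>2 m n"
    by (simp add: star_def linear_map_add[OF act(1)] linear_map_add[OF act(2)])
  with rota_baxter_star[OF rb12, of m n] rota_baxter_star[OF rb1, of m n]
    rota_baxter_star[OF rb2, of m n]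
  show ?thesis
    by (simp add: linear_map_add[OF lin(1)] linear_map_add[OF lin(2)] linear_map_add[OF mulL]
        linear_map_add[OF mulR] algebra_simps)
qed

text \<open>
  The Nijenhuis identity at \<open>a = T\<^sub>2 m\<close> and \<open>b = T\<^sub>2 n\<close>: the correction \<open>N (a \<cdot> b)\<close> is
  \<open>T\<^sub>1 (m \<star>\<^sub>2 n)\<close>, exactly the term that separates the cross identity from \<open>T\<^sub>2 (m \<star>\<^sub>1 n)\<close>.
\<close>

lemma intertwiner_nijenhuis:
  assumes alg: "anti_flexible_algebra sA mul"
    and bim: "anti_flexible_bimodule sA mul sM l r"
    and comp: "compatible_rota_baxter_operators sA mul sM l r T\<^sub>1 T\<^sub>2"
    and surj: "surj T\<^sub>2"
    and N: "Vector_Spaces.linear sA sA N" "\<And>m. N (T\<^sub>2 m) = T\<^sub>1 m"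
  shows "nijenhuis_operator sA mul N"
  unfolding nijenhuis_operator_def
proof (intro conjI allI)
  have rb: "rota_baxter_operator sA mul sM l r T\<^sub>1" "rota_baxter_operator sA mul sM l r T\<^sub>2"
    using comp by (auto simp: compatible_rota_baxter_operators_def)
  fix a b
  obtain m n where [simp]: "a = T\<^sub>2 m" "b = T\<^sub>2 n"
    using surj by (meson surjD)
  have "mul (N a) b + mul a (N b) - N (mul a b) = T\<^sub>2 (star l r T\<^sub>1 m n)"
    using compatible_cross_identity[OF alg bim comp, of m n]
    by (simp add: N(2) rota_baxter_star[OF rb(2)])
  then show "mul (N a) (N b) = N (mul (N a) b + mul a (N b) - N (mul a b))"
    by (simp add: N(2) rota_baxter_star[OF rb(1)])
qed (fact N(1))

text \<open>
  Here \<open>\<star>\<^sub>2\<close> is the product of \<open>A\<close> transported along \<open>T\<^sub>2\<close>, so pulling the cross identity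
  back along \<open>T\<^sub>2\<close> turns its left side into \<open>S m \<star>\<^sub>2 n + m \<star>\<^sub>2 S n\<close>.
\<close>

lemma intertwiner_deformed_star:
  assumes alg: "anti_flexible_algebra sA mul"
    and bim: "anti_flexible_bimodule sA mul sM l r"
    and comp: "compatible_rota_baxter_operators sA mul sM l r T\<^sub>1 T\<^sub>2"
    and inj: "inj T\<^sub>2"
    and S: "\<And>m. T\<^sub>2 (S m) = T\<^sub>1 m"
  shows "star l r T\<^sub>1 m n = deformed_star l r T\<^sub>2 S m n"
proof (rule injD[OF inj])
  have rb: "rota_baxter_operator sA mul sM l r T\<^sub>2"
    using comp by (auto simp: compatible_rota_baxter_operators_def)
  then have lin: "Vector_Spaces.linear sM sA T\<^sub>2"
    by (simp add: rota_baxter_operator_def)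
  have "T\<^sub>2 (deformed_star l r T\<^sub>2 S m n)
      = mul (T\<^sub>1 m) (T\<^sub>2 n) + mul (T\<^sub>2 m) (T\<^sub>1 n) - T\<^sub>1 (star l r T\<^sub>2 m n)"
    by (simp add: deformed_star_def linear_map_add[OF lin] linear_map_diff[OF lin] S
        flip: rota_baxter_star[OF rb])
  then show "T\<^sub>2 (star l r T\<^sub>1 m n) = T\<^sub>2 (deformed_star l r T\<^sub>2 S m n)"
    by (simp add: compatible_cross_identity[OF alg bim comp])
qed

text \<open>
  Since \<open>T\<^sub>2 \<circ> S = T\<^sub>1\<close>, the summands \<open>l (T\<^sub>2 (S m)) n\<close> and \<open>r (T\<^sub>2 (S n)) m\<close> of the deformed product
  already make up \<open>m \<star>\<^sub>1 n\<close>; the remaining ones must therefore sum to zero.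
\<close>

lemma intertwiner_twisted_derivation:
  assumes "anti_flexible_algebra sA mul"
    and "anti_flexible_bimodule sA mul sM l r"
    and "compatible_rota_baxter_operators sA mul sM l r T\<^sub>1 T\<^sub>2"
    and "inj T\<^sub>2"
    and S: "\<And>m. T\<^sub>2 (S m) = T\<^sub>1 m"
  shows "S (star l r T\<^sub>2 m n) = l (T\<^sub>2 m) (S n) + r (T\<^sub>2 n) (S m)"
  using intertwiner_deformed_star[OF assms, of m n]
  by (simp add: deformed_star_def star_def S algebra_simps)

lemma intertwiner_star_hom:
  assumes rb1: "rota_baxter_operator sA mul sM l r T\<^sub>1"
    and rb2: "rota_baxter_operator sA mul sM l r T\<^sub>2"
    and inj: "inj T\<^sub>2"
    and S: "\<And>m. T\<^sub>2 (S m) = T\<^sub>1 m"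
  shows "S (star l r T\<^sub>1 m n) = star l r T\<^sub>2 (S m) (S n)"
proof (rule injD[OF inj])
  show "T\<^sub>2 (S (star l r T\<^sub>1 m n)) = T\<^sub>2 (star l r T\<^sub>2 (S m) (S n))"
    by (simp add: S flip: rota_baxter_star[OF rb1] rota_baxter_star[OF rb2])
qed

lemma intertwiner_nijenhuis_structure:
  assumes alg: "anti_flexible_algebra sA mul"
    and bim: "anti_flexible_bimodule sA mul sM l r"
    and comp: "compatible_rota_baxter_operators sA mul sM l r T\<^sub>1 T\<^sub>2"
    and bij: "bij T\<^sub>2"
    and N: "Vector_Spaces.linear sA sA N" "\<And>m. N (T\<^sub>2 m) = T\<^sub>1 m"
    and S: "Vector_Spaces.linear sM sM S" "\<And>m. T\<^sub>2 (S m) = T\<^sub>1 m"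
  shows "nijenhuis_structure sA mul sM l r N S"
  unfolding nijenhuis_structure_def
proof (intro conjI allI)
  have inj: "inj T\<^sub>2" and surj: "surj T\<^sub>2"
    using bij by (simp_all add: bij_is_inj bij_is_surj)
  show "nijenhuis_operator sA mul N"
    by (rule intertwiner_nijenhuis[OF alg bim comp surj N])
  have rb: "rota_baxter_operator sA mul sM l r T\<^sub>1" "rota_baxter_operator sA mul sM l r T\<^sub>2"
    using comp by (auto simp: compatible_rota_baxter_operators_def)
  have der: "S (l (T\<^sub>2 m) n) + S (r (T\<^sub>2 n) m) = l (T\<^sub>2 m) (S n) + r (T\<^sub>2 n) (S m)" for m n
    using intertwiner_twisted_derivation[OF alg bim comp inj S(2), of m n]
    by (simp add: star_def linear_map_add[OF S(1)])
  have hom: "S (l (T\<^sub>1 m) n) + S (r (T\<^sub>1 n) m) = l (T\<^sub>1 m) (S n) + r (T\<^sub>1 n) (S m)" for m n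
    using intertwiner_star_hom[where S = S, OF rb inj S(2), of m n]
    by (simp add: star_def S(2) linear_map_add[OF S(1)])
  fix a m
  obtain n where a: "a = T\<^sub>2 n"
    using surj by (meson surjD)
  (* Twisted derivation at (n, S m) and homomorphism at (n, m): their r-terms agree. *)
  have "S (l (T\<^sub>1 n) m) + l (T\<^sub>2 n) (S (S m)) - S (l (T\<^sub>2 n) (S m)) - l (T\<^sub>1 n) (S m)
      = (l (T\<^sub>2 n) (S (S m)) + r (T\<^sub>1 m) (S n) - (S (l (T\<^sub>2 n) (S m)) + S (r (T\<^sub>1 m) n)))
        + (S (l (T\<^sub>1 n) m) + S (r (T\<^sub>1 m) n) - (l (T\<^sub>1 n) (S m) + r (T\<^sub>1 m) (S n)))"
    by (simp add: algebra_simps)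
  also have "\<dots> = 0"
    using der[of n "S m"] hom[of n m] by (simp add: S(2))
  finally show "l (N a) (S m) = S (l (N a) m) + l a (S (S m)) - S (l a (S m))"
    by (simp add: a N(2))
  (* The same with the arguments exchanged, (S m, n) and (m, n): now the l-terms agree. *)
  have "S (r (T\<^sub>1 n) m) + r (T\<^sub>2 n) (S (S m)) - S (r (T\<^sub>2 n) (S m)) - r (T\<^sub>1 n) (S m)
      = (l (T\<^sub>1 m) (S n) + r (T\<^sub>2 n) (S (S m)) - (S (l (T\<^sub>1 m) n) + S (r (T\<^sub>2 n) (S m))))
        + (S (l (T\<^sub>1 m) n) + S (r (T\<^sub>1 n) m) - (l (T\<^sub>1 m) (S n) + r (T\<^sub>1 n) (S m)))"
    by (simp add: algebra_simps)
  also have "\<dots> = 0"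
    using der[of "S m" n] hom[of m n] by (simp add: S(2))
  finally show "r (N a) (S m) = S (r (N a) m) + r a (S (S m)) - S (r a (S m))"
    by (simp add: a N(2))
qed (fact S(1))

theorem proposition5p7:
  fixes sA :: "complex \<Rightarrow> 'a::ab_group_add \<Rightarrow> 'a"
    and mul :: "'a \<Rightarrow> 'a \<Rightarrow> 'a"
    and sM :: "complex \<Rightarrow> 'm::ab_group_add \<Rightarrow> 'm"
    and l r :: "'a \<Rightarrow> 'm \<Rightarrow> 'm"
    and T\<^sub>1 T\<^sub>2 :: "'m \<Rightarrow> 'a"
  assumes "anti_flexible_algebra sA mul"
    and "anti_flexible_bimodule sA mul sM l r"
    and "compatible_rota_baxter_operators sA mul sM l r T\<^sub>1 T\<^sub>2"
    and "bij T\<^sub>2"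
  shows "ON_structure sA mul sM l r T\<^sub>2 (T\<^sub>1 \<circ> inv T\<^sub>2) (inv T\<^sub>2 \<circ> T\<^sub>1)"
proof -
  let ?N = "T\<^sub>1 \<circ> inv T\<^sub>2" and ?S = "inv T\<^sub>2 \<circ> T\<^sub>1"
  have rb2: "rota_baxter_operator sA mul sM l r T\<^sub>2"
    and lin: "Vector_Spaces.linear sM sA T\<^sub>1" "Vector_Spaces.linear sM sA T\<^sub>2"
    using assms(3) by (auto simp: compatible_rota_baxter_operators_def rota_baxter_operator_def)
  have linN: "Vector_Spaces.linear sA sA ?N" and linS: "Vector_Spaces.linear sM sM ?S"
    using Vector_Spaces.linear_compose[OF linear_inv_bij[OF lin(2) assms(4)] lin(1)]
      Vector_Spaces.linear_compose[OF lin(1) linear_inv_bij[OF lin(2) assms(4)]] by blast+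
  have N: "?N (T\<^sub>2 m) = T\<^sub>1 m" and S: "T\<^sub>2 (?S m) = T\<^sub>1 m" for m
    using assms(4) by (simp_all add: bij_is_inj bij_is_surj surj_f_inv_f)
  have NT: "?N \<circ> T\<^sub>2 = T\<^sub>1" and TS: "T\<^sub>2 \<circ> ?S = T\<^sub>1"
    using N S by (auto simp: fun_eq_iff)
  show ?thesis
    unfolding ON_structure_def NT TS
    using rb2 intertwiner_nijenhuis_structure[OF assms linN N linS S]
      intertwiner_deformed_star[where S = ?S, OF assms(1-3) bij_is_inj[OF assms(4)] S]
    by blast
qed

end
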